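(* Let $d\le 3$ be a positive integer. Consider constants $a_1,a_2>0$ and $b_1,b_2\ge 0$, and a unit vector $\bm{u}\in\mathbb{R}^d$. Then $\mathcal{T}^{(3)}_{a_1,a_2,b_1,b_2,\bm{u}}[\mathcal{W}]$ is a stationary covariance function in $\mathbb{R}^d$.
   Context: A function $C:\mathbb{R}^d\to\mathbb{R}$ is a stationary covariance function in $\mathbb{R}^d$ if $(\bm{x},\bm{x}')\mapsto C(\bm{x}-\bm{x}')$ is the covariance function of a second-order zero-mean random field on $\mathbb{R}^d$, i.e. is (symmetric) positive semidefinite: $\sum_{i,j=1}^n v_iv_jC(\bm{x}_i-\bm{x}_j)\ge 0$ for all $n\in\mathbb{N}$, $v_1,\dots,v_n\in\mathbb{R}$, $\bm{x}_1,\dots,\bm{x}_n\in\mathbb{R}^d$. For $\varphi:[0,\infty)\to\mathbb{R}$, $$\mathcal{T}^{(3)}_{a_1,a_2,b_1,b_2,\bm{u}}[\varphi](\bm{h})=b_1\,\varphi(\sqrt{a_1}\,\|\bm{h}\|)-b_2\left[\cos^2(\theta(\bm{h},\bm{u}))\,\varphi''(\sqrt{a_2}\,\|\bm{h}\|)+\sin^2(\theta(\bm{h},\bm{u}))\,\frac{\varphi'(\sqrt{a_2}\,\|\bm{h}\|)}{\sqrt{a_2}\,\|\bm{h}\|}\right],\quad \bm{h}\in\mathbb{R}^d,$$ where $\|\cdot\|$ is the Euclidean norm and $\theta(\bm{h},\bm{u})$ is the angle between $\bm{h}$ and $\bm{u}$; at $\bm{h}=\bm{0}$ the bracket is understood by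 continuity, i.e. as $\varphi''(0)$. The cardinal sine (wave) model is $\mathcal{W}(t)=\sin(t)/t$ for $t>0$ and $\mathcal{W}(0)=1$. *)

theory Defs
  imports "HOL-Analysis.Analysis" "HOL-Probability.Sinc_Integral"
begin

definition stationary_covariance :: "(real ^ 'd \<Rightarrow> real) \<Rightarrow> bool" where
  "stationary_covariance C \<longleftrightarrow>
     (\<forall>h. C (- h) = C h) \<and>
     (\<forall>(n::nat) (v :: nat \<Rightarrow> real) (x :: nat \<Rightarrow> real ^ 'd).
        (\<Sum>i<n. \<Sum>j<n. v i * v j * C (x i - x j)) \<ge> 0)"

text \<open>The value is irrelevant if one of the vectors is zero.\<close>
definition vec_angle :: "real ^ 'd \<Rightarrow> real ^ 'd \<Rightarrow> real" where
  "vec_angle h u = arccos (h \<bullet> u / (norm h * norm u))"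

text \<open>A function on the half-line \<open>[0, \<infinity>)\<close> is represented by a total function on the
  reals. Derivatives are taken within \<open>{0..}\<close>, hence one-sided at \<open>0\<close>, and do
  not depend on the values at negative arguments.\<close>
definition deriv_nonneg :: "(real \<Rightarrow> real) \<Rightarrow> real \<Rightarrow> real" where
  "deriv_nonneg \<phi> t = vector_derivative \<phi> (at t within {0..})"

text \<open>At \<open>h = 0\<close> the bracket is its limit \<open>\<phi>''(0)\<close>.\<close>
definition T3 :: "real \<Rightarrow> real \<Rightarrow> real \<Rightarrow> real \<Rightarrow> real ^ 'd \<Rightarrow> (real \<Rightarrow> real) \<Rightarrow> real ^ 'd \<Rightarrow> real" where
  "T3 a1 a2 b1 b2 u \<phi> h =
     b1 * \<phi> (sqrt a1 * norm h) -
     b2 * (if h = 0 then deriv_nonneg (deriv_nonneg \<phi>) 0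
           else (cos (vec_angle h u))\<^sup>2 * deriv_nonneg (deriv_nonneg \<phi>) (sqrt a2 * norm h) +
                (sin (vec_angle h u))\<^sup>2 *
                  (deriv_nonneg \<phi> (sqrt a2 * norm h) / (sqrt a2 * norm h)))"

end

theory Submission
  imports Defs "HOL-Real_Asymp.Real_Asymp"
begin

text \<open>
  The transformed model is a nonnegative combination of two positive semidefinite functions of
  rescaled arguments: the wave model \<open>h \<mapsto> sinc (norm h)\<close>, positive semidefinite in dimension at
  most three, and minus its second derivative along the unit vector \<open>u\<close>, which is what the bracket
  computes.

  \<^bold>\<open>The wave model.\<close> In three dimensions \<open>4 * pi * sinc (norm h)\<close> is the integral of
  \<open>cos (h \<bullet> \<omega>)\<close> over the unit sphere (\<open>sphere_wave_integral_eq_sinc\<close>), hence a mixture of the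
  positive semidefinite functions \<open>h \<mapsto> cos (h \<bullet> \<omega>)\<close>. The integral is taken in spherical
  coordinates. It is invariant under rotations of \<open>h\<close> because its derivative along a rotation is
  the integral of a divergence over a closed surface; this reduces its evaluation to vectors \<open>h\<close> on
  the polar axis, where it is elementary. Smaller dimensions follow by an isometric embedding into
  the three-dimensional space.

  \<^bold>\<open>The bracket.\<close> If \<open>C\<close> is positive semidefinite, then so is
  \<open>h \<mapsto> 2 * C h - C (h + e) - C (h - e)\<close>: this is the covariance of the increment over \<open>e\<close> of a
  field with covariance \<open>C\<close>. Dividing by \<open>t\<^sup>2\<close>, where \<open>e = t *\<^sub>R u\<close>, and letting \<open>t\<close> tend to \<open>0\<close> shows
  that minus the second derivative of \<open>C\<close> along \<open>u\<close> is positive semidefinite. For a radial function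
  this second derivative is computed by the chain rule
  (\<open>tendsto_second_difference_radial\<close>).
\<close>

section \<open>Positive semidefinite functions\<close>

definition positive_semidefinite_fun :: "('a::ab_group_add \<Rightarrow> real) \<Rightarrow> bool" where
  "positive_semidefinite_fun C \<longleftrightarrow>
     (\<forall>(n::nat) (v :: nat \<Rightarrow> real) x. (\<Sum>i<n. \<Sum>j<n. v i * v j * C (x i - x j)) \<ge> 0)"

lemma positive_semidefinite_funD:
  "positive_semidefinite_fun C \<Longrightarrow> (\<Sum>i<(n::nat). \<Sum>j<n. v i * v j * C (x i - x j)) \<ge> 0"
  by (simp add: positive_semidefinite_fun_def)

lemma positive_semidefinite_fun_cmult:
  assumes "positive_semidefinite_fun C" "c \<ge> 0"
  shows "positive_semidefinite_fun (\<lambda>h. c * C h)"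
  unfolding positive_semidefinite_fun_def
proof (intro allI)
  fix n :: nat and v :: "nat \<Rightarrow> real" and x :: "nat \<Rightarrow> 'a"
  have "(\<Sum>i<n. \<Sum>j<n. v i * v j * (c * C (x i - x j))) = c * (\<Sum>i<n. \<Sum>j<n. v i * v j * C (x i - x j))"
    by (simp add: sum_distrib_left algebra_simps)
  then show "(\<Sum>i<n. \<Sum>j<n. v i * v j * (c * C (x i - x j))) \<ge> 0"
    using positive_semidefinite_funD[OF assms(1), where n = n and v = v and x = x] assms(2) by simp
qed

lemma positive_semidefinite_fun_add:
  assumes "positive_semidefinite_fun C" "positive_semidefinite_fun D"
  shows "positive_semidefinite_fun (\<lambda>h. C h + D h)"
  unfolding positive_semidefinite_fun_def distrib_left sum.distrib
  by (intro allI add_nonneg_nonneg positive_semidefinite_funD assms)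

lemma positive_semidefinite_fun_compose_additive:
  assumes "positive_semidefinite_fun C" "\<And>x y. f (x - y) = f x - f y"
  shows "positive_semidefinite_fun (\<lambda>h. C (f h))"
  unfolding positive_semidefinite_fun_def assms(2)
  by (intro allI positive_semidefinite_funD[OF assms(1)])

lemma positive_semidefinite_fun_limit:
  assumes psd: "\<And>k. positive_semidefinite_fun (C k)" and lim: "\<And>h. (\<lambda>k::nat. C k h) \<longlonglongrightarrow> D h"
  shows "positive_semidefinite_fun D"
  unfolding positive_semidefinite_fun_def
proof (intro allI)
  fix n :: nat and v :: "nat \<Rightarrow> real" and x :: "nat \<Rightarrow> 'a"
  have "(\<lambda>k. \<Sum>i<n. \<Sum>j<n. v i * v j * C k (x i - x j)) \<longlonglongrightarrow> (\<Sum>i<n. \<Sum>j<n. v i * v j * D (x i - x j))"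
    by (intro tendsto_sum tendsto_mult tendsto_const lim)
  then show "(\<Sum>i<n. \<Sum>j<n. v i * v j * D (x i - x j)) \<ge> 0"
    by (rule LIMSEQ_le_const) (intro exI allI impI positive_semidefinite_funD[OF psd])
qed

text \<open>
  The weights \<open>v\<close> at the points \<open>x\<close> together with the weights \<open>- v\<close> at the shifted points \<open>x + e\<close>
  turn the quadratic form of \<open>C\<close> into that of its second difference.
\<close>

lemma positive_semidefinite_fun_second_difference:
  assumes "positive_semidefinite_fun C"
  shows "positive_semidefinite_fun (\<lambda>h. 2 * C h - C (h + e) - C (h - e))"
  unfolding positive_semidefinite_fun_def
proof (intro allI)
  fix n :: nat and v :: "nat \<Rightarrow> real" and x :: "nat \<Rightarrow> 'a"
  \<comment> \<open>indices below \<open>n\<close> are the original points, indices from \<open>n\<close> on the shifted ones\<close>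
  define V where "V i = (if i < n then v i else - v (i - n))" for i
  define X where "X i = (if i < n then x i else x (i - n) + e)" for i
  have split: "(\<Sum>i<n+m. g i) = (\<Sum>i<n. g i) + (\<Sum>i<m. g (i + n))" for g :: "nat \<Rightarrow> real" and m
    by (induction m) (auto simp: add_ac)
  have "0 \<le> (\<Sum>i<n+n. \<Sum>j<n+n. V i * V j * C (X i - X j))"
    by (rule positive_semidefinite_funD[OF assms])
  also have "\<dots> = (\<Sum>i<n. \<Sum>j<n.
      (V i * V j * C (X i - X j) + V i * V (j + n) * C (X i - X (j + n))) +
      (V (i + n) * V j * C (X (i + n) - X j) + V (i + n) * V (j + n) * C (X (i + n) - X (j + n))))"
    by (simp only: split sum.distrib)
  also have "\<dots> = (\<Sum>i<n. \<Sum>j<n.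
      v i * v j * (2 * C (x i - x j) - C (x i - x j + e) - C (x i - x j - e)))"
  proof (intro sum.cong refl)
    fix i j assume "i \<in> {..<n}" "j \<in> {..<n}"
    have shifts: "x i + e - x j = x i - x j + e" "x i - (x j + e) = x i - x j - e"
      "x i + e - (x j + e) = x i - x j"
      by (simp_all add: algebra_simps)
    show "(V i * V j * C (X i - X j) + V i * V (j + n) * C (X i - X (j + n))) +
      (V (i + n) * V j * C (X (i + n) - X j) + V (i + n) * V (j + n) * C (X (i + n) - X (j + n)))
      = v i * v j * (2 * C (x i - x j) - C (x i - x j + e) - C (x i - x j - e))"
      using \<open>i \<in> {..<n}\<close> \<open>j \<in> {..<n}\<close>
      by (simp add: V_def X_def shifts right_diff_distrib)
  qed
  finally show "(\<Sum>i<n. \<Sum>j<n. v i * v j * (2 * C (x i - x j) - C (x i - x j + e) - C (x i - x j - e))) \<ge> 0" .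
qed

section \<open>The wave model as an integral over the sphere\<close>

text \<open>
  Spherical coordinates: the argument is the pair of the polar angle and the azimuth, and the polar
  axis is the first coordinate axis. The area element is \<open>sin (fst w)\<close>.
\<close>
definition sphere_point :: "real \<times> real \<Rightarrow> real \<times> real \<times> real" where
  "sphere_point w = (cos (fst w), sin (fst w) * cos (snd w), sin (fst w) * sin (snd w))"

abbreviation angle_box :: "(real \<times> real) set" where
  "angle_box \<equiv> cbox (0, 0) (pi, 2 * pi)"

definition sphere_wave_integral :: "real \<times> real \<times> real \<Rightarrow> real" where
  "sphere_wave_integral h = integral angle_box (\<lambda>w. cos (h \<bullet> sphere_point w) * sin (fst w))"

text \<open>
  This is the inner product of \<open>sphere_point w\<close> with the vector of length \<open>R\<close>, polar angle \<open>\<tau>\<close> and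
  azimuth \<open>\<alpha>\<close>. Varying \<open>\<tau>\<close> rotates this vector in a plane through the polar axis.
\<close>
definition rotated_phase :: "real \<Rightarrow> real \<Rightarrow> real \<Rightarrow> real \<times> real \<Rightarrow> real" where
  "rotated_phase R \<alpha> \<tau> w =
     R * (sin \<tau> * sin (fst w) * cos (snd w - \<alpha>) + cos \<tau> * cos (fst w))"

lemma continuous_on_rotated_phase [continuous_intros]:
  fixes S :: "'a::t2_space set"
  assumes "continuous_on S f" "continuous_on S g"
  shows "continuous_on S (\<lambda>x. rotated_phase R \<alpha> (f x) (g x))"
  unfolding rotated_phase_def using assms by (intro continuous_intros)

text \<open>
  The integrand is the derivative of \<open>cos (rotated_phase R \<alpha> \<tau> w) * sin (fst w)\<close> with respect to
  \<open>\<tau>\<close>. Changing \<open>\<tau>\<close> amounts to moving \<open>w\<close> along the vector field that generates the opposite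
  rotation of the sphere, and such a field has divergence zero. The integrand is therefore a
  divergence on the sphere. In coordinates it is the sum of
  \<open>- \<partial>\<theta> (sin \<theta> * cos (\<phi> - \<alpha>) * cos p)\<close> and \<open>\<partial>\<phi> (cos \<theta> * sin (\<phi> - \<alpha>) * cos p)\<close>, where \<open>p\<close> is
  the phase; the first integrates to zero because \<open>sin\<close> vanishes at both poles, the second by
  periodicity.
\<close>

lemma integral_rotated_phase_derivative_eq_0:
  "integral angle_box (\<lambda>w. - sin (rotated_phase R \<alpha> \<tau> w) *
     (R * (cos \<tau> * sin (fst w) * cos (snd w - \<alpha>) - sin \<tau> * cos (fst w))) * sin (fst w)) = 0"
proof -
  define p where "p \<theta> \<phi> = rotated_phase R \<alpha> \<tau> (\<theta>, \<phi>)" for \<theta> \<phi>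
  define p\<theta> where "p\<theta> \<theta> \<phi> = R * (sin \<tau> * cos \<theta> * cos (\<phi> - \<alpha>) - cos \<tau> * sin \<theta>)" for \<theta> \<phi>
  define p\<phi> where "p\<phi> \<theta> \<phi> = - (R * sin \<tau> * sin \<theta> * sin (\<phi> - \<alpha>))" for \<theta> \<phi>
  \<comment> \<open>the two terms of the divergence; the products \<open>cos \<theta> * cos (\<phi> - \<alpha>) * cos p\<close> cancel in their sum\<close>
  define A where "A \<theta> \<phi> = - (cos \<theta> * cos (\<phi> - \<alpha>) * cos (p \<theta> \<phi>)
      - sin \<theta> * cos (\<phi> - \<alpha>) * (sin (p \<theta> \<phi>) * p\<theta> \<theta> \<phi>))" for \<theta> \<phi>
  define B where "B \<theta> \<phi> = cos \<theta> * cos (\<phi> - \<alpha>) * cos (p \<theta> \<phi>)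
      - cos \<theta> * sin (\<phi> - \<alpha>) * (sin (p \<theta> \<phi>) * p\<phi> \<theta> \<phi>)" for \<theta> \<phi>
  have contA: "continuous_on S (\<lambda>(\<theta>, \<phi>). A \<theta> \<phi>)" and contB: "continuous_on S (\<lambda>(\<theta>, \<phi>). B \<theta> \<phi>)" for S
    unfolding A_def B_def p_def p\<theta>_def p\<phi>_def case_prod_unfold
    by (intro continuous_intros)+
  have dp\<theta>: "((\<lambda>\<theta>. p \<theta> \<phi>) has_real_derivative p\<theta> \<theta> \<phi>) (at \<theta> within S)" for \<theta> \<phi> S
    unfolding p_def p\<theta>_def rotated_phase_def
    by (auto intro!: derivative_eq_intros simp: algebra_simps)
  have dp\<phi>: "((\<lambda>\<phi>. p \<theta> \<phi>) has_real_derivative p\<phi> \<theta> \<phi>) (at \<phi> within S)" for \<theta> \<phi> S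
    unfolding p_def p\<phi>_def rotated_phase_def
    by (auto intro!: derivative_eq_intros simp: algebra_simps)
  have intA: "integral (cbox 0 pi) (\<lambda>\<theta>. A \<theta> \<phi>) = 0" for \<phi>
  proof -
    have "((\<lambda>\<theta>. A \<theta> \<phi>) has_integral
        (- (sin pi * cos (\<phi> - \<alpha>) * cos (p pi \<phi>)) - (- (sin 0 * cos (\<phi> - \<alpha>) * cos (p 0 \<phi>))))) {0..pi}"
    proof (rule fundamental_theorem_of_calculus)
      show "((\<lambda>\<theta>. - (sin \<theta> * cos (\<phi> - \<alpha>) * cos (p \<theta> \<phi>))) has_vector_derivative A \<theta> \<phi>)
          (at \<theta> within {0..pi})" for \<theta>
        unfolding has_real_derivative_iff_has_vector_derivative[symmetric] A_def
        by (auto intro!: derivative_eq_intros dp\<theta> simp: algebra_simps)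
    qed simp
    then show ?thesis by (simp add: integral_unique)
  qed
  have intB: "integral (cbox 0 (2 * pi)) (\<lambda>\<phi>. B \<theta> \<phi>) = 0" for \<theta>
  proof -
    have "((\<lambda>\<phi>. B \<theta> \<phi>) has_integral
        (cos \<theta> * sin (2 * pi - \<alpha>) * cos (p \<theta> (2 * pi)) - cos \<theta> * sin (0 - \<alpha>) * cos (p \<theta> 0))) {0..2 * pi}"
    proof (rule fundamental_theorem_of_calculus)
      show "((\<lambda>\<phi>. cos \<theta> * sin (\<phi> - \<alpha>) * cos (p \<theta> \<phi>)) has_vector_derivative B \<theta> \<phi>)
          (at \<phi> within {0..2 * pi})" for \<phi>
        unfolding has_real_derivative_iff_has_vector_derivative[symmetric] B_def
        by (auto intro!: derivative_eq_intros dp\<phi> simp: algebra_simps)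
    qed simp
    then show ?thesis
      by (simp add: integral_unique p_def rotated_phase_def cos_diff sin_diff)
  qed
  have "integral angle_box (\<lambda>w. - sin (rotated_phase R \<alpha> \<tau> w) *
      (R * (cos \<tau> * sin (fst w) * cos (snd w - \<alpha>) - sin \<tau> * cos (fst w))) * sin (fst w))
    = integral angle_box (\<lambda>w. (case w of (\<theta>, \<phi>) \<Rightarrow> A \<theta> \<phi>) + (case w of (\<theta>, \<phi>) \<Rightarrow> B \<theta> \<phi>))"
  proof (rule integral_cong, clarify)
    fix \<theta> \<phi> :: real
    have "sin (\<phi> - \<alpha>) ^ 2 = 1 - cos (\<phi> - \<alpha>) ^ 2" by (rule sin_squared_eq)
    then have "- (cos \<tau> * sin \<theta> * cos (\<phi> - \<alpha>) - sin \<tau> * cos \<theta>) * sin \<theta>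
       = sin \<theta> * cos (\<phi> - \<alpha>) * (sin \<tau> * cos \<theta> * cos (\<phi> - \<alpha>) - cos \<tau> * sin \<theta>)
         + cos \<theta> * sin (\<phi> - \<alpha>) * (sin \<tau> * sin \<theta> * sin (\<phi> - \<alpha>))"
      by algebra
    then show "- sin (rotated_phase R \<alpha> \<tau> (\<theta>, \<phi>)) *
        (R * (cos \<tau> * sin (fst (\<theta>, \<phi>)) * cos (snd (\<theta>, \<phi>) - \<alpha>) - sin \<tau> * cos (fst (\<theta>, \<phi>)))) *
        sin (fst (\<theta>, \<phi>)) = A \<theta> \<phi> + B \<theta> \<phi>"
      unfolding A_def B_def p\<theta>_def p\<phi>_def p_def[symmetric] fst_conv snd_conv
      by algebra
  qed
  also have "\<dots> = integral angle_box (\<lambda>(\<theta>, \<phi>). A \<theta> \<phi>) + integral angle_box (\<lambda>(\<theta>, \<phi>). B \<theta> \<phi>)"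
    by (intro integral_add integrable_continuous contA contB)
  also have "integral angle_box (\<lambda>(\<theta>, \<phi>). A \<theta> \<phi>) = 0"
    using integral_prod_continuous[OF contA] integral_swap_continuous[OF contA] intA by simp
  also have "integral angle_box (\<lambda>(\<theta>, \<phi>). B \<theta> \<phi>) = 0"
    using integral_prod_continuous[OF contB] intB by simp
  finally show ?thesis by simp
qed

lemma integral_rotated_phase_constant:
  "integral angle_box (\<lambda>w. cos (rotated_phase R \<alpha> \<tau> w) * sin (fst w)) =
   integral angle_box (\<lambda>w. cos (rotated_phase R \<alpha> 0 w) * sin (fst w))"
proof -
  let ?G = "\<lambda>\<tau>. integral angle_box (\<lambda>w. cos (rotated_phase R \<alpha> \<tau> w) * sin (fst w))"
  have "\<forall>\<tau>. (?G has_real_derivative 0) (at \<tau>)"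
  proof
    fix \<tau>
    have "(?G has_real_derivative integral angle_box (\<lambda>w. - sin (rotated_phase R \<alpha> \<tau> w) *
       (R * (cos \<tau> * sin (fst w) * cos (snd w - \<alpha>) - sin \<tau> * cos (fst w))) * sin (fst w))) (at \<tau> within UNIV)"
    proof (rule leibniz_rule_field_derivative)
      show "((\<lambda>\<tau>. cos (rotated_phase R \<alpha> \<tau> w) * sin (fst w)) has_real_derivative - sin (rotated_phase R \<alpha> \<tau> w) *
       (R * (cos \<tau> * sin (fst w) * cos (snd w - \<alpha>) - sin \<tau> * cos (fst w))) * sin (fst w)) (at \<tau> within UNIV)" for \<tau> w
        unfolding rotated_phase_def by (auto intro!: derivative_eq_intros simp: algebra_simps)
      show "(\<lambda>w. cos (rotated_phase R \<alpha> \<tau> w) * sin (fst w)) integrable_on angle_box" for \<tau>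
        by (intro integrable_continuous continuous_intros)
      show "continuous_on (UNIV \<times> angle_box) (\<lambda>(\<tau>, w). - sin (rotated_phase R \<alpha> \<tau> w) *
       (R * (cos \<tau> * sin (fst w) * cos (snd w - \<alpha>) - sin \<tau> * cos (fst w))) * sin (fst w))"
        unfolding case_prod_unfold by (intro continuous_intros)
    qed auto
    then show "(?G has_real_derivative 0) (at \<tau>)"
      by (simp only: integral_rotated_phase_derivative_eq_0)
  qed
  then show ?thesis by (rule DERIV_isconst_all)
qed

lemma integral_rotated_phase_pole:
  "integral angle_box (\<lambda>w. cos (rotated_phase R \<alpha> 0 w) * sin (fst w)) = 4 * pi * sinc R"
proof -
  have "integral {0..pi} (\<lambda>\<theta>. cos (R * cos \<theta>) * sin \<theta>) = 2 * sinc R"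
  proof (cases "R = 0")
    case True
    have "(sin has_integral (- cos pi - (- cos 0))) {0..pi}"
      by (rule fundamental_theorem_of_calculus)
        (auto intro!: derivative_eq_intros simp flip: has_real_derivative_iff_has_vector_derivative)
    then show ?thesis using True by (simp add: integral_unique)
  next
    case False
    have "((\<lambda>\<theta>. cos (R * cos \<theta>) * sin \<theta>) has_integral
       (- sin (R * cos pi) / R - (- sin (R * cos 0) / R))) {0..pi}"
      by (rule fundamental_theorem_of_calculus)
        (use False in \<open>auto intro!: derivative_eq_intros simp flip: has_real_derivative_iff_has_vector_derivative\<close>)
    then show ?thesis using False by (simp add: integral_unique)
  qed
  moreover have "integral angle_box (\<lambda>w. cos (rotated_phase R \<alpha> 0 w) * sin (fst w)) =
      2 * pi * integral {0..pi} (\<lambda>\<theta>. cos (R * cos \<theta>) * sin \<theta>)"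
  proof -
    define f where "f \<theta> = cos (R * cos \<theta>) * sin \<theta>" for \<theta>
    have "continuous_on angle_box (\<lambda>w. f (fst w))"
      unfolding f_def by (intro continuous_intros)
    from integral_prod_continuous[OF this]
    have "integral angle_box (\<lambda>w. f (fst w)) = 2 * pi * integral {0..pi} f"
      by simp
    then show ?thesis
      by (simp add: rotated_phase_def f_def[abs_def])
  qed
  ultimately show ?thesis by simp
qed

text \<open>
  Writing \<open>h\<close> in spherical coordinates turns the integral into one over a rotated phase, and the
  rotation can be undone until \<open>h\<close> lies on the polar axis.
\<close>

lemma sphere_wave_integral_eq_sinc:
  "sphere_wave_integral h = 4 * pi * sinc (norm h)"
proof -
  obtain c a b where h: "h = (c, a, b)" by (metis prod.exhaust)
  have polar: "\<exists>\<rho> t. \<rho> \<ge> 0 \<and> x = \<rho> * cos t \<and> y = \<rho> * sin t" for x y :: real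
    using rcis_cmod_Arg[of "Complex x y"]
    by (metis Re_rcis Im_rcis complex.sel norm_ge_zero)
  obtain \<rho> \<alpha> where \<rho>: "a = \<rho> * cos \<alpha>" "b = \<rho> * sin \<alpha>" using polar by blast
  obtain R \<tau> where R: "R \<ge> 0" "c = R * cos \<tau>" "\<rho> = R * sin \<tau>" using polar by blast
  have "h \<bullet> sphere_point w = rotated_phase R \<alpha> \<tau> w" for w
    unfolding h sphere_point_def rotated_phase_def \<rho> R by (simp add: cos_diff algebra_simps)
  moreover have "norm h = R"
  proof -
    have "(norm h)\<^sup>2 = (R * cos \<tau>)\<^sup>2 + (R * sin \<tau> * cos \<alpha>)\<^sup>2 + (R * sin \<tau> * sin \<alpha>)\<^sup>2"
      unfolding power2_norm_eq_inner h \<rho> R by (simp add: power2_eq_square)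
    also have "\<dots> = R\<^sup>2 * ((cos \<tau>)\<^sup>2 + (sin \<tau>)\<^sup>2 * ((cos \<alpha>)\<^sup>2 + (sin \<alpha>)\<^sup>2))"
      by (simp only: power_mult_distrib distrib_left mult.assoc add.assoc)
    also have "\<dots> = R\<^sup>2"
      by simp
    finally show ?thesis using R(1) by simp
  qed
  ultimately show ?thesis
    by (simp only: sphere_wave_integral_def
        integral_rotated_phase_constant[of R \<alpha> \<tau>] integral_rotated_phase_pole)
qed

text \<open>The quadratic form is the squared modulus of the exponential sum of the \<open>v i * cis (y i)\<close>.\<close>

lemma quadratic_form_cos_nonneg:
  fixes v y :: "nat \<Rightarrow> real"
  shows "(\<Sum>i<n. \<Sum>j<n. v i * v j * cos (y i - y j)) \<ge> 0"
proof -
  have "(\<Sum>i<n. \<Sum>j<n. v i * v j * cos (y i - y j))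
     = (\<Sum>i<n. v i * cos (y i))\<^sup>2 + (\<Sum>i<n. v i * sin (y i))\<^sup>2"
    by (simp add: power2_eq_square sum_product cos_diff algebra_simps sum.distrib)
  then show ?thesis by simp
qed

lemma positive_semidefinite_sphere_wave_integral:
  "positive_semidefinite_fun sphere_wave_integral"
  unfolding positive_semidefinite_fun_def
proof (intro allI)
  fix n :: nat and v :: "nat \<Rightarrow> real" and x :: "nat \<Rightarrow> real \<times> real \<times> real"
  have cont: "continuous_on angle_box (\<lambda>w. v i * v j * (cos ((x i - x j) \<bullet> sphere_point w) * sin (fst w)))" for i j
    unfolding sphere_point_def by (intro continuous_intros)
  have "(\<Sum>i<n. \<Sum>j<n. v i * v j * sphere_wave_integral (x i - x j)) =
    integral angle_box (\<lambda>w. \<Sum>i<n. \<Sum>j<n. v i * v j * (cos ((x i - x j) \<bullet> sphere_point w) * sin (fst w)))"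
    unfolding sphere_wave_integral_def
    by (simp add: integral_sum integrable_sum integrable_continuous[OF cont])
  also have "\<dots> \<ge> 0"
  proof (rule integral_nonneg)
    show "(\<lambda>w. \<Sum>i<n. \<Sum>j<n. v i * v j * (cos ((x i - x j) \<bullet> sphere_point w) * sin (fst w))) integrable_on angle_box"
      by (intro integrable_sum integrable_continuous[OF cont]) auto
    fix w assume "w \<in> angle_box"
    then have "sin (fst w) \<ge> 0" by (cases w) (auto simp: cbox_Pair_eq sin_ge_zero)
    then have "(\<Sum>i<n. \<Sum>j<n. v i * v j * cos (x i \<bullet> sphere_point w - x j \<bullet> sphere_point w)) * sin (fst w) \<ge> 0"
      using quadratic_form_cos_nonneg by simp
    then show "(\<Sum>i<n. \<Sum>j<n. v i * v j * (cos ((x i - x j) \<bullet> sphere_point w) * sin (fst w))) \<ge> 0"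
      by (simp add: sum_distrib_right inner_diff_left mult.assoc)
  qed
  finally show "(\<Sum>i<n. \<Sum>j<n. v i * v j * sphere_wave_integral (x i - x j)) \<ge> 0" .
qed

lemma ex_linear_isometry_into:
  assumes "DIM('a) \<le> DIM('b)"
  obtains f :: "'a::euclidean_space \<Rightarrow> 'b::euclidean_space" where "linear f" "\<And>x. norm (f x) = norm x"
proof -
  have "DIM('a) \<le> dim (UNIV :: 'b set)" using assms by simp
  then obtain T :: "'b set" where T: "subspace T" "dim T = DIM('a)"
    by (metis choose_subspace_of_subspace)
  have "dim (UNIV :: 'a set) = dim T" using T by simp
  then obtain f :: "'a \<Rightarrow> 'b" where "linear f" "\<And>x. x \<in> UNIV \<Longrightarrow> norm (f x) = norm x"
    using isometry_subspaces[OF subspace_UNIV T(1)] by metis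
  then show ?thesis using that by auto
qed

lemma positive_semidefinite_sinc_norm:
  assumes "DIM('a::euclidean_space) \<le> 3"
  shows "positive_semidefinite_fun (\<lambda>h::'a. sinc (norm h))"
proof -
  have "DIM('a) \<le> DIM(real \<times> real \<times> real)" using assms by simp
  then obtain f :: "'a \<Rightarrow> real \<times> real \<times> real" where f: "linear f" "\<And>x. norm (f x) = norm x"
    by (rule ex_linear_isometry_into) blast
  have "positive_semidefinite_fun (\<lambda>h. 1 / (4 * pi) * sphere_wave_integral (f h))"
    by (intro positive_semidefinite_fun_cmult
        positive_semidefinite_fun_compose_additive[OF positive_semidefinite_sphere_wave_integral]
        linear_diff[OF f(1)]) simp
  moreover have "(\<lambda>h. 1 / (4 * pi) * sphere_wave_integral (f h)) = (\<lambda>h. sinc (norm h))"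
    by (simp add: sphere_wave_integral_eq_sinc f(2) fun_eq_iff)
  ultimately show ?thesis by simp
qed

section \<open>Second derivatives of radial functions\<close>

text \<open>
  By l'Hospital's rule the limit is that of \<open>(g' (- t) - g' t) / (2 * t)\<close>, which is minus the mean
  of the two difference quotients of \<open>g'\<close> at \<open>0\<close>.
\<close>

lemma tendsto_symmetric_second_difference:
  fixes g g' :: "real \<Rightarrow> real"
  assumes g: "eventually (\<lambda>t. (g has_real_derivative g' t) (at t)) (nhds 0)"
    and g': "(g' has_real_derivative D) (at 0)"
  shows "((\<lambda>t. (2 * g 0 - g t - g (- t)) / t\<^sup>2) \<longlongrightarrow> - D) (at_right 0)"
proof (rule lhopital_right_0)
  have mirror: "eventually P (nhds 0) \<Longrightarrow> eventually (\<lambda>t. P (- t)) (nhds (0::real))" for P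
    using filterlim_iff[THEN iffD1, OF tendsto_minus[OF filterlim_ident[of "nhds (0::real)"]]] by simp
  have right: "eventually P (nhds 0) \<Longrightarrow> eventually P (at_right (0::real))" for P
    using at_le eventually_mono filter_leD by (metis at_within_le_nhds)
  have "(g \<longlongrightarrow> g 0) (at 0)"
    using eventually_nhds_x_imp_x[OF g] DERIV_isCont isCont_def by blast
  then have cont: "(g \<longlongrightarrow> g 0) (nhds 0)" by (simp add: tendsto_at_iff_tendsto_nhds)
  have "((\<lambda>t. g (- t)) \<longlongrightarrow> g 0) (nhds 0)"
    by (rule filterlim_compose[OF cont]) (use tendsto_minus[OF filterlim_ident[of "nhds (0::real)"]] in simp)
  then have "((\<lambda>t. 2 * g 0 - g t - g (- t)) \<longlongrightarrow> 2 * g 0 - g 0 - g 0) (nhds 0)"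
    by (intro tendsto_intros cont)
  then show "((\<lambda>t. 2 * g 0 - g t - g (- t)) \<longlongrightarrow> 0) (at_right 0)"
    by (simp add: tendsto_mono[OF at_within_le_nhds])
  show "((\<lambda>t::real. t\<^sup>2) \<longlongrightarrow> 0) (at_right 0)"
    by (auto intro!: tendsto_eq_intros)
  show "\<forall>\<^sub>F t in at_right 0. t\<^sup>2 \<noteq> (0::real)" "\<forall>\<^sub>F t in at_right 0. 2 * t \<noteq> (0::real)"
    by (auto simp: eventually_at_filter)
  show "\<forall>\<^sub>F t in at_right 0. ((\<lambda>t. t\<^sup>2) has_real_derivative 2 * t) (at t)"
    by (intro always_eventually allI) (auto intro!: derivative_eq_intros)
  show "\<forall>\<^sub>F t in at_right 0. ((\<lambda>t. 2 * g 0 - g t - g (- t)) has_real_derivative g' (- t) - g' t) (at t)"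
    using right[OF g] right[OF mirror[OF g]]
  proof eventually_elim
    case (elim t)
    have "((\<lambda>t. g (- t)) has_real_derivative - g' (- t)) (at t)"
      using elim(2) by (simp add: DERIV_mirror)
    from DERIV_diff[OF DERIV_diff[OF DERIV_const elim(1)] this] show ?case by simp
  qed
  have quot: "((\<lambda>t. (g' t - g' 0) / t) \<longlongrightarrow> D) (at 0)"
    using g' by (simp add: has_field_derivative_iff)
  have "((\<lambda>t. (g' (- t) - g' 0) / - t) \<longlongrightarrow> D) (at 0)"
    by (rule filterlim_compose[OF quot, of uminus]) real_asymp
  then have "((\<lambda>t. - (((g' t - g' 0) / t + (g' (- t) - g' 0) / - t) / 2)) \<longlongrightarrow> - ((D + D) / 2)) (at_right 0)"
    using quot by (intro tendsto_intros tendsto_mono[OF at_le[of "{0<..}" UNIV]]) auto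
  then have "((\<lambda>t. - (((g' t - g' 0) / t + (g' (- t) - g' 0) / - t) / 2)) \<longlongrightarrow> - D) (at_right 0)"
    by simp
  then show "((\<lambda>t. (g' (- t) - g' t) / (2 * t)) \<longlongrightarrow> - D) (at_right 0)"
    by (rule Lim_transform_eventually) (auto simp: eventually_at_filter field_simps)
qed

text \<open>
  The chain rule for \<open>h \<mapsto> \<phi> (norm h)\<close>: the Hessian of this function has the eigenvalue
  \<open>\<phi>'' (norm h)\<close> in the direction of \<open>h\<close> and \<open>\<phi>' (norm h) / norm h\<close> orthogonally to it. Here \<open>\<phi>'\<close>
  and \<open>\<phi>''\<close> stand for the derivatives of the profile \<open>\<phi>\<close> and \<open>u\<close> for a unit vector, so that
  \<open>h \<bullet> u / norm h\<close> is the cosine of the angle between \<open>h\<close> and \<open>u\<close>.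
\<close>
definition radial_second_derivative ::
    "(real \<Rightarrow> real) \<Rightarrow> (real \<Rightarrow> real) \<Rightarrow> 'a::real_inner \<Rightarrow> 'a \<Rightarrow> real" where
  "radial_second_derivative \<phi>' \<phi>'' u h =
     (if h = 0 then \<phi>'' 0
      else (h \<bullet> u / norm h)\<^sup>2 * \<phi>'' (norm h) + (1 - (h \<bullet> u / norm h)\<^sup>2) * (\<phi>' (norm h) / norm h))"

text \<open>
  Away from the origin the second derivative follows from differentiating
  \<open>norm (h + t *\<^sub>R u)\<close> as the square root of a quadratic polynomial in \<open>t\<close>. On the line through the
  origin the function is \<open>t \<mapsto> \<phi> \<bar>t\<bar>\<close>, which is \<open>\<phi>\<close> itself since \<open>\<phi>\<close> is even.
\<close>

lemma tendsto_second_difference_radial: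
  fixes h u :: "'a::real_inner" and \<phi> \<phi>' \<phi>'' :: "real \<Rightarrow> real"
  assumes \<phi>: "\<And>t. (\<phi> has_real_derivative \<phi>' t) (at t)"
    and \<phi>': "\<And>t. (\<phi>' has_real_derivative \<phi>'' t) (at t)"
    and even: "\<And>t. \<phi> (- t) = \<phi> t" and u: "norm u = 1"
  shows "((\<lambda>t. (2 * \<phi> (norm h) - \<phi> (norm (h + t *\<^sub>R u)) - \<phi> (norm (h - t *\<^sub>R u))) / t\<^sup>2)
    \<longlongrightarrow> - radial_second_derivative \<phi>' \<phi>'' u h) (at_right 0)"
proof (cases "h = 0")
  case True
  have abs: "\<phi> \<bar>t\<bar> = \<phi> t" for t
    by (cases "t < 0") (simp_all add: abs_if even)
  have "eventually (\<lambda>t. (\<phi> has_real_derivative \<phi>' t) (at t)) (nhds 0)"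
    by (intro always_eventually allI \<phi>)
  from tendsto_symmetric_second_difference[OF this \<phi>']
  have "((\<lambda>t. (2 * \<phi> 0 - \<phi> t - \<phi> (- t)) / t\<^sup>2) \<longlongrightarrow> - \<phi>'' 0) (at_right 0)" .
  moreover have "\<phi> (norm (h + t *\<^sub>R u)) = \<phi> t" "\<phi> (norm (h - t *\<^sub>R u)) = \<phi> (- t)" for t
    using u abs[of t] even[of t] by (simp_all add: True)
  ultimately show ?thesis
    by (simp add: True radial_second_derivative_def)
next
  case False
  define c where "c = h \<bullet> u"
  define N where "N t = norm (h + t *\<^sub>R u)" for t
  have N0: "N 0 = norm h" by (simp add: N_def)
  define q where "q t = (norm h)\<^sup>2 + 2 * t * c + t\<^sup>2" for t
  have N_q: "N = (\<lambda>t. sqrt (q t))"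
  proof
    fix t
    have "(N t)\<^sup>2 = q t"
      unfolding N_def c_def q_def power2_norm_eq_inner using u[unfolded norm_eq_1]
      by (simp add: inner_add_left inner_add_right inner_commute[of u h] power2_eq_square distrib_left)
    then have "sqrt (q t) = sqrt ((N t)\<^sup>2)" by simp
    then show "N t = sqrt (q t)" by (simp add: N_def)
  qed
  have dN: "(N has_real_derivative (c + t) / N t) (at t)" if "N t \<noteq> 0" for t
  proof -
    have "N t > 0" using that by (simp add: N_def)
    then have pos: "q t > 0" unfolding N_q by simp
    have dq: "(q has_real_derivative 2 * c + 2 * t) (at t)"
      unfolding q_def by (auto intro!: derivative_eq_intros)
    have "((\<lambda>s. sqrt (q s)) has_real_derivative inverse (sqrt (q t)) / 2 * (2 * c + 2 * t)) (at t)"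
      by (rule DERIV_chain2[where f = sqrt and g = q and x = t, OF DERIV_real_sqrt[OF pos] dq])
    moreover have "inverse (sqrt (q t)) / 2 * (2 * c + 2 * t) = (c + t) / sqrt (q t)"
      using pos by (simp add: field_simps)
    ultimately show ?thesis by (simp only: N_q)
  qed
  have "isCont N 0"
    using dN[of 0] False N0 by (intro DERIV_isCont[of N]) simp
  then have "eventually (\<lambda>t. N t \<noteq> 0) (at 0)"
    unfolding isCont_def by (rule tendsto_imp_eventually_ne) (use False N0 in simp)
  then have ev: "eventually (\<lambda>t. N t \<noteq> 0) (nhds 0)"
    using False N0 by (simp add: eventually_nhds_conv_at)
  have g: "eventually (\<lambda>t. ((\<lambda>t. \<phi> (N t)) has_real_derivative \<phi>' (N t) * ((c + t) / N t)) (at t)) (nhds 0)"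
    using ev by eventually_elim (rule DERIV_chain2[where f = \<phi> and g = N, OF \<phi> dN])
  have g': "((\<lambda>t. \<phi>' (N t) * ((c + t) / N t)) has_real_derivative
      (c / norm h)\<^sup>2 * \<phi>'' (norm h) + (1 - (c / norm h)\<^sup>2) * (\<phi>' (norm h) / norm h)) (at 0)"
  proof -
    have "N 0 \<noteq> 0" using False N0 by simp
    then have N: "(N has_real_derivative c / N 0) (at 0)" using dN[of 0] by simp
    have "((\<lambda>t. \<phi>' (N t)) has_real_derivative \<phi>'' (N 0) * (c / N 0)) (at 0)"
      by (rule DERIV_chain2[where f = \<phi>' and g = N and x = 0, OF \<phi>' N])
    moreover have "((\<lambda>t. (c + t) / N t) has_real_derivative (1 * N 0 - (c + 0) * (c / N 0)) / (N 0 * N 0)) (at 0)"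
      by (rule DERIV_divide[OF _ N \<open>N 0 \<noteq> 0\<close>]) (auto intro!: derivative_eq_intros)
    ultimately have "((\<lambda>t. \<phi>' (N t) * ((c + t) / N t)) has_real_derivative
        \<phi>'' (N 0) * (c / N 0) * ((c + 0) / N 0)
        + (1 * N 0 - (c + 0) * (c / N 0)) / (N 0 * N 0) * \<phi>' (N 0)) (at 0)"
      by (rule DERIV_mult)
    moreover have "\<phi>'' (N 0) * (c / N 0) * ((c + 0) / N 0)
        + (1 * N 0 - (c + 0) * (c / N 0)) / (N 0 * N 0) * \<phi>' (N 0)
      = (c / N 0)\<^sup>2 * \<phi>'' (N 0) + (1 - (c / N 0)\<^sup>2) * (\<phi>' (N 0) / N 0)"
      using \<open>N 0 \<noteq> 0\<close> by (simp add: field_simps power2_eq_square)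
    ultimately show ?thesis unfolding N0 by simp
  qed
  have minus: "\<phi> (N (- t)) = \<phi> (norm (h - t *\<^sub>R u))" for t by (simp add: N_def)
  show ?thesis
    using tendsto_symmetric_second_difference[OF g g'] False
    unfolding minus N0 by (simp add: c_def N_def radial_second_derivative_def)
qed

lemma positive_semidefinite_minus_radial_second_derivative:
  fixes u :: "'a::real_inner" and \<phi> \<phi>' \<phi>'' :: "real \<Rightarrow> real"
  assumes psd: "positive_semidefinite_fun (\<lambda>h::'a. \<phi> (norm h))"
    and \<phi>: "\<And>t. (\<phi> has_real_derivative \<phi>' t) (at t)"
    and \<phi>': "\<And>t. (\<phi>' has_real_derivative \<phi>'' t) (at t)"
    and even: "\<And>t. \<phi> (- t) = \<phi> t" and u: "norm u = 1"
  shows "positive_semidefinite_fun (\<lambda>h. - radial_second_derivative \<phi>' \<phi>'' u h)"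
proof (rule positive_semidefinite_fun_limit)
  define t where "t k = inverse (real (Suc k))" for k
  have "filterlim t (at_right 0) sequentially"
    unfolding t_def using LIMSEQ_inverse_real_of_nat
    by (auto simp: filterlim_at intro!: always_eventually)
  then show "(\<lambda>k. 1 / (t k)\<^sup>2 * (2 * \<phi> (norm h) - \<phi> (norm (h + t k *\<^sub>R u)) - \<phi> (norm (h - t k *\<^sub>R u))))
      \<longlonglongrightarrow> - radial_second_derivative \<phi>' \<phi>'' u h" for h
    using filterlim_compose[OF tendsto_second_difference_radial[OF \<phi> \<phi>' even u, of h]] by simp
  show "positive_semidefinite_fun (\<lambda>h.
      1 / (t k)\<^sup>2 * (2 * \<phi> (norm h) - \<phi> (norm (h + t k *\<^sub>R u)) - \<phi> (norm (h - t k *\<^sub>R u))))" for k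
    by (intro positive_semidefinite_fun_cmult positive_semidefinite_fun_second_difference[OF psd]) simp
qed

section \<open>The transformed wave model\<close>

definition sinc' :: "real \<Rightarrow> real" where
  "sinc' t = (if t = 0 then 0 else (t * cos t - sin t) / t\<^sup>2)"

definition sinc'' :: "real \<Rightarrow> real" where
  "sinc'' t = (if t = 0 then - 1 / 3 else (2 * sin t - 2 * t * cos t - t\<^sup>2 * sin t) / t ^ 3)"

lemma DERIV_sinc: "(sinc has_real_derivative sinc' t) (at t)"
proof (cases "t = 0")
  case True
  have "((\<lambda>x::real. (sin x / x - 1) / x) \<longlongrightarrow> 0) (at 0)" by real_asymp
  then have "((\<lambda>x::real. (sinc x - sinc 0) / (x - 0)) \<longlongrightarrow> 0) (at 0)"
    by (rule Lim_transform_eventually) (auto simp: eventually_at_filter)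
  then show ?thesis using True unfolding has_field_derivative_iff sinc'_def by simp
next
  case False
  have "((\<lambda>x. sin x / x) has_real_derivative sinc' t) (at t)"
    using False by (auto intro!: derivative_eq_intros simp: sinc'_def field_simps power2_eq_square)
  then show ?thesis
    by (rule has_field_derivative_transform_within_open[where S = "- {0}"]) (use False in auto)
qed

lemma DERIV_sinc': "(sinc' has_real_derivative sinc'' t) (at t)"
proof (cases "t = 0")
  case True
  have "((\<lambda>x::real. (x * cos x - sin x) / x\<^sup>2 / x) \<longlongrightarrow> - 1 / 3) (at 0)" by real_asymp
  then have "((\<lambda>x. (sinc' x - sinc' 0) / (x - 0)) \<longlongrightarrow> - 1 / 3) (at 0)"
    by (rule Lim_transform_eventually) (auto simp: eventually_at_filter sinc'_def)
  then show ?thesis using True unfolding has_field_derivative_iff sinc''_def by simp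
next
  case False
  have "((\<lambda>x. (x * cos x - sin x) / x\<^sup>2) has_real_derivative sinc'' t) (at t)"
    using False by (auto intro!: derivative_eq_intros simp: sinc''_def field_simps power2_eq_square power3_eq_cube)
  then show ?thesis
    by (rule has_field_derivative_transform_within_open[where S = "- {0}"]) (use False in \<open>auto simp: sinc'_def\<close>)
qed

lemma deriv_nonneg_eqI:
  assumes "(f has_real_derivative D) (at t)" "\<And>s. s \<ge> 0 \<Longrightarrow> g s = f s" "t \<ge> 0"
  shows "deriv_nonneg g t = D"
  unfolding deriv_nonneg_def
proof (rule vector_derivative_within)
  have "at_right t \<le> at t within {0..}" using assms(3) by (intro at_le) auto
  then show "at t within {0..} \<noteq> bot" using trivial_limit_at_right_real[of t] bot.extremum_unique by metis
  have "(f has_vector_derivative D) (at t within {0..})"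
    using assms(1) has_real_derivative_iff_has_vector_derivative has_vector_derivative_at_within by blast
  then show "(g has_vector_derivative D) (at t within {0..})"
    by (rule has_vector_derivative_transform[rotated 2]) (use assms in auto)
qed

lemma deriv_nonneg_sinc: "t \<ge> 0 \<Longrightarrow> deriv_nonneg sinc t = sinc' t"
  by (rule deriv_nonneg_eqI[OF DERIV_sinc refl])

lemma deriv_nonneg_deriv_nonneg_sinc: "t \<ge> 0 \<Longrightarrow> deriv_nonneg (deriv_nonneg sinc) t = sinc'' t"
  by (rule deriv_nonneg_eqI[OF DERIV_sinc' deriv_nonneg_sinc])

lemma cos_vec_angle:
  fixes h u :: "real ^ 'd"
  shows "cos (vec_angle h u) = h \<bullet> u / (norm h * norm u)"
proof -
  have "\<bar>h \<bullet> u / (norm h * norm u)\<bar> \<le> 1"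
    using Cauchy_Schwarz_ineq2[of h u] by (simp add: abs_mult divide_le_eq)
  then show ?thesis unfolding vec_angle_def by (simp add: cos_arccos_abs)
qed

text \<open>The angle between \<open>h\<close> and \<open>u\<close> does not change when \<open>h\<close> is scaled by \<open>sqrt a2\<close>.\<close>

lemma T3_sinc_eq:
  fixes h u :: "real ^ 'd"
  assumes u: "norm u = 1" and "a1 > 0" and "a2 > 0"
  shows "T3 a1 a2 b1 b2 u sinc h = b1 * sinc (norm (sqrt a1 *\<^sub>R h)) +
    b2 * - radial_second_derivative sinc' sinc'' u (sqrt a2 *\<^sub>R h)"
proof -
  define k where "k = sqrt a2 *\<^sub>R h"
  have k: "norm k = sqrt a2 * norm h" "k \<bullet> u / (sqrt a2 * norm h) = h \<bullet> u / norm h" "k = 0 \<longleftrightarrow> h = 0"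
    using assms by (auto simp: k_def)
  have "(sin (vec_angle h u))\<^sup>2 = 1 - (h \<bullet> u / norm h)\<^sup>2"
    unfolding sin_squared_eq cos_vec_angle using u by simp
  then show ?thesis
    unfolding T3_def k_def[symmetric] radial_second_derivative_def k using assms
    by (auto simp: cos_vec_angle deriv_nonneg_deriv_nonneg_sinc deriv_nonneg_sinc)
qed

theorem corollary4p4:
  fixes a1 a2 b1 b2 :: real and u :: "real ^ 'd"
  assumes "CARD('d) \<le> 3"
    and "a1 > 0" and "a2 > 0" and "b1 \<ge> 0" and "b2 \<ge> 0"
    and "norm u = 1"
  shows "stationary_covariance (T3 a1 a2 b1 b2 u sinc)"
proof -
  have T3: "T3 a1 a2 b1 b2 u sinc = (\<lambda>h. b1 * sinc (norm (sqrt a1 *\<^sub>R h)) +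
      b2 * - radial_second_derivative sinc' sinc'' u (sqrt a2 *\<^sub>R h))"
    by (intro ext T3_sinc_eq assms)
  have wave: "positive_semidefinite_fun (\<lambda>h::real ^ 'd. sinc (norm h))"
    using assms(1) by (intro positive_semidefinite_sinc_norm) simp
  have bracket: "positive_semidefinite_fun (\<lambda>h. - radial_second_derivative sinc' sinc'' u h)"
    by (rule positive_semidefinite_minus_radial_second_derivative[OF wave DERIV_sinc DERIV_sinc'
          sinc_neg assms(6)])
  have "positive_semidefinite_fun (T3 a1 a2 b1 b2 u sinc)"
    unfolding T3
    by (intro positive_semidefinite_fun_add positive_semidefinite_fun_cmult assms(4,5)
        positive_semidefinite_fun_compose_additive[OF wave, of "\<lambda>h. sqrt a1 *\<^sub>R h"]
        positive_semidefinite_fun_compose_additive[OF bracket, of "\<lambda>h. sqrt a2 *\<^sub>R h"]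
        scaleR_diff_right)
  moreover have "T3 a1 a2 b1 b2 u sinc (- h) = T3 a1 a2 b1 b2 u sinc h" for h
    unfolding T3 radial_second_derivative_def by simp
  ultimately show ?thesis
    by (simp add: stationary_covariance_def positive_semidefinite_fun_def)
qed

end
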